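(* Let $r \ge 1$ be an integer and let $G$ be a graph of order $n$ with independence number $\alpha(G) = \alpha$. Then (a) $\Gamma_{d,r}(K_n) \le r \log(n+1)$, and (b) $\Gamma_{d,r}(G) \le r\alpha\left(1 + 2\ln(n/\alpha)\right)$.
   Context: $\log$ is base $2$, $\ln$ is natural logarithm. For a digraph $D$ and integer $r \ge 1$, a directed $r$-dominating set is a set $S \subseteq V(D)$ such that every vertex $u \notin S$ has at least $r$ vertices $v \in S$ with arc $(v,u)$; $\gamma_r(D)$ is the minimum size of such a set. For a graph $G$, $\Gamma_{d,r}(G) = \max\{\gamma_r(D) : D \text{ an orientation of } G\}$. *)

theory Defs
  imports Complex_Main "Graph_Theory.Graph_Theory"
begin

text \<open>Finite simple graphs are the symmetric, loop-free pair digraphs of the locale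
  \<^locale>\<open>pair_graph\<close>: an edge between \<open>u\<close> and \<open>v\<close> is the pair of opposite arcs
  \<open>(u, v)\<close> and \<open>(v, u)\<close>. The null graph is allowed.\<close>

definition independent_set :: "'a pair_pre_digraph \<Rightarrow> 'a set \<Rightarrow> bool" where
  "independent_set G I \<longleftrightarrow> I \<subseteq> pverts G \<and> (\<forall>u\<in>I. \<forall>v\<in>I. (u, v) \<notin> parcs G)"

definition independence_number :: "'a pair_pre_digraph \<Rightarrow> nat" where
  "independence_number G = Max {card I | I. independent_set G I}"

text \<open>Of the two arcs representing an edge of the graph, an orientation keeps exactly one.\<close>

definition orientation :: "'a pair_pre_digraph \<Rightarrow> 'a pair_pre_digraph \<Rightarrow> bool" where
  "orientation G D \<longleftrightarrow>
     pverts D = pverts G \<and> parcs D \<subseteq> parcs G \<and>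
     (\<forall>(u, v) \<in> parcs G. (u, v) \<in> parcs D \<longleftrightarrow> (v, u) \<notin> parcs D)"

definition directed_dominating_set :: "nat \<Rightarrow> 'a pair_pre_digraph \<Rightarrow> 'a set \<Rightarrow> bool" where
  "directed_dominating_set r D S \<longleftrightarrow>
     S \<subseteq> pverts D \<and> (\<forall>u \<in> pverts D - S. r \<le> card {v \<in> S. (v, u) \<in> parcs D})"

definition directed_domination_number :: "nat \<Rightarrow> 'a pair_pre_digraph \<Rightarrow> nat" where
  "directed_domination_number r D = Min {card S | S. directed_dominating_set r D S}"

definition upper_directed_domination_number :: "nat \<Rightarrow> 'a pair_pre_digraph \<Rightarrow> nat" where
  "upper_directed_domination_number r G =
     Max {directed_domination_number r D | D. orientation G D}"

end

theory Submission
  imports Defs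
begin

text \<open>Turan's bound, applied to the graph underlying an oriented graph with \<open>m > 0\<close> vertices and no
  independent set of more than \<open>a\<close> vertices, gives by averaging a vertex whose closed
  out-neighbourhood has \<open>c\<close> elements, where \<open>2 a c \<ge> m + a\<close>. Picking such vertices greedily
  produces a dominating set of size at most \<open>g m\<close> for every \<open>g\<close> with \<open>1 + g (m - c) \<le> g m\<close>:
  for \<open>a = 1\<close> take \<open>g m = log 2 (m + 1)\<close>; in general take
  \<open>g m = a (1 + 2 ln (m / a))\<close>, replaced by \<open>m\<close> for \<open>m \<le> a\<close>. Removing a
  dominating set and repeating the construction \<open>r\<close> times gives an \<open>r\<close>-dominating set.\<close>

section \<open>Turan's bound and large out-neighbourhoods\<close>

text \<open>Phrased for a bare relation, so that it applies alike to the arcs of a graph, to those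
  of an orientation and to a symmetric closure. As \<open>I \<times> I\<close> contains both orders
  of each pair, one arc of an edge already destroys independence.\<close>

definition indep_at_most :: "('a \<times> 'a) set \<Rightarrow> nat \<Rightarrow> 'a set \<Rightarrow> bool" where
  "indep_at_most R a U \<longleftrightarrow> (\<forall>I\<subseteq>U. I \<times> I \<inter> R = {} \<longrightarrow> card I \<le> a)"

lemma indep_at_mostD: "indep_at_most R a U \<Longrightarrow> I \<subseteq> U \<Longrightarrow> I \<times> I \<inter> R = {} \<Longrightarrow> card I \<le> a"
  unfolding indep_at_most_def by blast

lemma indep_at_most_subset: "indep_at_most R a U \<Longrightarrow> V \<subseteq> U \<Longrightarrow> indep_at_most R a V"
  unfolding indep_at_most_def by blast

text \<open>Turan's theorem in terms of closed degrees, by induction on \<open>a\<close>: a vertex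
  of minimum degree extends every independent set that avoids its closed neighbourhood, so deleting
  that neighbourhood lowers \<open>a\<close> by one.\<close>

lemma turan_closed_degrees:
  assumes "finite U" "sym E" "irrefl E" "indep_at_most E a U"
  shows "(card U)\<^sup>2 \<le> a * (\<Sum>u\<in>U. card {v\<in>U. v = u \<or> (u, v) \<in> E})"
  using assms(1,4)
proof (induction a arbitrary: U)
  case 0
  have "U = {}"
  proof (rule ccontr)
    assume "U \<noteq> {}"
    then obtain u where "u \<in> U" by blast
    moreover have "{u} \<times> {u} \<inter> E = {}" using assms(3) by (auto simp: irrefl_def)
    ultimately have "card {u} \<le> 0" by (intro indep_at_mostD[OF 0(2)]) auto
    then show False by simp
  qed
  then show ?case by simp
next
  case (Suc b)
  define N where "N W u = {v\<in>W. v = u \<or> (u, v) \<in> E}" for W u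
  show ?case
  proof (cases "U = {}")
    case False
    then obtain v where v: "v \<in> U" "\<And>u. u \<in> U \<Longrightarrow> card (N U v) \<le> card (N U u)"
      using arg_min_if_finite(1)[OF Suc.prems(1) False, of "\<lambda>u. card (N U u)"]
        arg_min_least[OF Suc.prems(1) False, of _ "\<lambda>u. card (N U u)"] by blast
    define k where "k = card (N U v)"
    define W where "W = U - N U v"
    define A where "A = (\<Sum>u\<in>W. card (N W u))"
    have NU: "N U v \<subseteq> U" by (auto simp: N_def)
    have fin: "finite W" "finite (N U v)"
      using Suc.prems(1) NU by (auto simp: W_def intro: finite_subset)
    have cU: "card U = k + card W"
      using Suc.prems(1) NU by (simp add: W_def k_def card_Diff_subset fin card_mono)
    have "indep_at_most E b W"
      unfolding indep_at_most_def
    proof (intro allI impI)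
      fix I assume I: "I \<subseteq> W" "I \<times> I \<inter> E = {}"
      have "insert v I \<times> insert v I \<inter> E = {}"
        using I assms(2,3) v(1) by (auto simp: W_def N_def irrefl_def dest: symD)
      moreover have "insert v I \<subseteq> U" using I v(1) by (auto simp: W_def)
      ultimately have "card (insert v I) \<le> Suc b"
        by (intro indep_at_mostD[OF Suc.prems(2)])
      moreover have "v \<notin> I" using I v(1) by (auto simp: W_def N_def)
      moreover have "finite I" using I fin finite_subset by blast
      ultimately show "card I \<le> b" by simp
    qed
    then have IH: "(card W)\<^sup>2 \<le> b * A"
      using Suc.IH[OF fin(1)] by (simp add: A_def N_def)
    \<comment> \<open>By minimality each of the \<open>k\<close> vertices in \<open>N U v\<close>
      has closed degree at least \<open>k\<close>; the other vertices only lose neighbours when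
      \<open>U\<close> shrinks to \<open>W\<close>.\<close>
    have "k * k + A \<le> (\<Sum>u\<in>N U v. card (N U u)) + (\<Sum>u\<in>W. card (N U u))"
    proof (rule add_mono)
      have "(\<Sum>u\<in>N U v. k) \<le> (\<Sum>u\<in>N U v. card (N U u))"
        using v(2) NU unfolding k_def by (intro sum_mono) auto
      then show "k * k \<le> (\<Sum>u\<in>N U v. card (N U u))" by (simp add: k_def)
      show "A \<le> (\<Sum>u\<in>W. card (N U u))"
        unfolding A_def using Suc.prems(1)
        by (intro sum_mono card_mono) (auto simp: N_def W_def)
    qed
    also have "\<dots> = (\<Sum>u\<in>U. card (N U u))"
      using sum.subset_diff[OF NU Suc.prems(1), of "\<lambda>u. card (N U u)"]
      by (simp add: W_def add.commute)
    finally have sum: "k * k + A \<le> (\<Sum>u\<in>U. card (N U u))" .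
    \<comment> \<open>The cross term of \<open>(k + card W)\<^sup>2\<close>; \<open>IH\<close> takes
      care of \<open>(card W)\<^sup>2\<close>. It follows from
      \<open>(b * k - card W)\<^sup>2 \<ge> 0\<close> and \<open>IH\<close> after cancelling
      \<open>b\<close>; for \<open>b = 0\<close>, \<open>IH\<close> forces
      \<open>card W = 0\<close>.\<close>
    have "2 * k * card W \<le> b * k\<^sup>2 + A"
    proof (cases "b = 0")
      case False
      have "real (2 * (b * k) * card W) \<le> real ((b * k)\<^sup>2 + (card W)\<^sup>2)"
        using sum_squares_bound[of "real (b * k)" "real (card W)"] by simp
      then have am_gm: "2 * (b * k) * card W \<le> (b * k)\<^sup>2 + (card W)\<^sup>2"
        by (simp only: of_nat_le_iff)
      have "b * (2 * k * card W) = 2 * (b * k) * card W" by simp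
      also have "\<dots> \<le> (b * k)\<^sup>2 + (card W)\<^sup>2" by (rule am_gm)
      also have "\<dots> \<le> (b * k)\<^sup>2 + b * A" using IH by simp
      also have "\<dots> = b * (b * k\<^sup>2 + A)" by (simp add: power2_eq_square algebra_simps)
      finally show ?thesis using False by simp
    qed (use IH in simp)
    then have "(card U)\<^sup>2 \<le> Suc b * (k * k + A)"
      using IH by (simp add: cU power2_eq_square algebra_simps)
    also have "\<dots> \<le> Suc b * (\<Sum>u\<in>U. card (N U u))" using sum by (rule mult_le_mono2)
    finally show ?thesis by (simp add: N_def)
  qed simp
qed

text \<open>In the symmetric closure of \<open>R\<close> a closed degree is one plus out-degree plus
  in-degree, by asymmetry. In-degrees and out-degrees have the same sum, so Turan's bound becomes
  one on out-degrees alone, and some vertex reaches the average.\<close>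

lemma ex_large_closed_out_neighbourhood:
  assumes "finite U" "U \<noteq> {}" "asym R" "indep_at_most R a U"
  obtains v where "v \<in> U" "card U + a \<le> 2 * a * card (insert v {w\<in>U. (v, w) \<in> R})"
proof -
  define out where "out u = {w\<in>U. (u, w) \<in> R}" for u
  define inn where "inn u = {w\<in>U. (w, u) \<in> R}" for u
  have irr: "(u, u) \<notin> R" for u using assms(3) by (auto dest: asymD)
  have fin: "finite (out u)" "finite (inn u)" for u using assms(1) by (auto simp: out_def inn_def)
  have deg: "card {v\<in>U. v = u \<or> (u, v) \<in> R \<union> R\<inverse>} = 1 + card (out u) + card (inn u)"
    if "u \<in> U" for u
  proof -
    have "{v\<in>U. v = u \<or> (u, v) \<in> R \<union> R\<inverse>} = insert u (out u \<union> inn u)"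
      using that by (auto simp: out_def inn_def)
    moreover have "out u \<inter> inn u = {}" using assms(3) by (auto simp: out_def inn_def dest: asymD)
    moreover have "u \<notin> out u \<union> inn u" using irr by (auto simp: out_def inn_def)
    ultimately show ?thesis using fin by (simp add: card_Un_disjoint)
  qed
  have swap: "(\<Sum>u\<in>U. card (inn u)) = (\<Sum>u\<in>U. card (out u))"
    using sum.swap_restrict[OF assms(1,1), of "\<lambda>_ _. 1::nat" "\<lambda>u w. (w, u) \<in> R"]
    by (simp add: out_def inn_def)
  have "indep_at_most (R \<union> R\<inverse>) a U"
    using assms(4) unfolding indep_at_most_def by blast
  moreover have "irrefl (R \<union> R\<inverse>)" using irr by (auto simp: irrefl_def)
  moreover have "sym (R \<union> R\<inverse>)" by (rule sym_Un_converse)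
  ultimately have "(card U)\<^sup>2 \<le> a * (\<Sum>u\<in>U. card {v\<in>U. v = u \<or> (u, v) \<in> R \<union> R\<inverse>})"
    using turan_closed_degrees[OF assms(1)] by blast
  also have "\<dots> = a * (\<Sum>u\<in>U. 1 + card (out u) + card (inn u))"
    using deg by simp
  also have "\<dots> = (\<Sum>u\<in>U. a * (2 * card (out u) + 1))"
    by (simp only: sum.distrib swap flip: sum_distrib_left) (simp add: algebra_simps)
  finally have turan: "(card U)\<^sup>2 \<le> (\<Sum>u\<in>U. a * (2 * card (out u) + 1))" .
  have "\<exists>v\<in>U. card U \<le> a * (2 * card (out v) + 1)"
  proof (rule ccontr)
    assume "\<not> ?thesis"
    then have "(\<Sum>u\<in>U. a * (2 * card (out u) + 1)) < (\<Sum>u\<in>U. card U)"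
      using assms(1,2) by (intro sum_strict_mono) auto
    then show False using turan by (simp add: power2_eq_square)
  qed
  then obtain v where v: "v \<in> U" "card U \<le> a * (2 * card (out v) + 1)" by blast
  have "v \<notin> out v" using irr by (simp add: out_def)
  then have "card (insert v (out v)) = card (out v) + 1" using fin by simp
  \<comment> \<open>With \<open>d\<close> the out-degree of \<open>v\<close>, adding
    \<open>a\<close> to both sides turns \<open>a * (2 * d + 1)\<close> into
    \<open>2 * a * (d + 1)\<close>.\<close>
  then have "card U + a \<le> 2 * a * card (insert v (out v))"
    using v(2) by (simp add: algebra_simps)
  then show ?thesis using that v(1) by (simp add: out_def)
qed

section \<open>Greedy construction of dominating sets\<close>

text \<open>The chosen vertex dominates the rest of its closed out-neighbourhood \<open>C\<close>,
  and induction handles \<open>U - C\<close>, which inherits the bound \<open>a\<close>. The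
  recursive inequality for \<open>g\<close> pays for the one vertex added; it is asked only for the
  sizes \<open>c\<close> that \<open>C\<close> can have.\<close>

lemma ex_small_dominating_set:
  fixes g :: "nat \<Rightarrow> real"
  assumes "finite U" "asym R" "indep_at_most R a U"
    and g0: "0 \<le> g 0"
    and g: "\<And>m c. 0 < c \<Longrightarrow> c \<le> m \<Longrightarrow> m + a \<le> 2 * a * c \<Longrightarrow> 1 + g (m - c) \<le> g m"
  shows "\<exists>S\<subseteq>U. (\<forall>u\<in>U - S. \<exists>v\<in>S. (v, u) \<in> R) \<and> real (card S) \<le> g (card U)"
  using assms(1,3)
proof (induction U rule: finite_psubset_induct)
  case (psubset U)
  show ?case
  proof (cases "U = {}")
    case True
    then show ?thesis using g0 by simp
  next
    case False
    obtain v where v: "v \<in> U" "card U + a \<le> 2 * a * card (insert v {w\<in>U. (v, w) \<in> R})"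
      using ex_large_closed_out_neighbourhood[OF psubset.hyps False assms(2) psubset.prems] .
    define C where "C = insert v {w\<in>U. (v, w) \<in> R}"
    have C: "C \<subseteq> U" "v \<in> C" using v(1) by (auto simp: C_def)
    have finC: "finite C" using C psubset.hyps finite_subset by blast
    have "U - C \<subset> U" using C v(1) by blast
    then obtain S where S: "S \<subseteq> U - C" "\<And>u. u \<in> U - C - S \<Longrightarrow> \<exists>v\<in>S. (v, u) \<in> R"
      "real (card S) \<le> g (card (U - C))"
      using psubset.IH[of "U - C"] indep_at_most_subset[OF psubset.prems] by blast
    have "finite S" using S(1) psubset.hyps finite_subset by blast
    moreover have "v \<notin> S" using S(1) C by blast
    ultimately have "real (card (insert v S)) = 1 + real (card S)" by simp
    also have "\<dots> \<le> 1 + g (card U - card C)"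
      using S(3) C finC by (simp add: card_Diff_subset)
    also have "\<dots> \<le> g (card U)"
      using v(2) C finC psubset.hyps
      by (intro g) (auto simp: C_def[symmetric] card_gt_0_iff intro: card_mono)
    finally have "real (card (insert v S)) \<le> g (card U)" .
    moreover have "\<forall>u\<in>U - insert v S. \<exists>w\<in>insert v S. (w, u) \<in> R"
      using S(2) by (auto simp: C_def)
    moreover have "insert v S \<subseteq> U" using S(1) v(1) by blast
    ultimately show ?thesis by blast
  qed
qed

text \<open>Each round adds a dominating set \<open>T\<close> of what \<open>S\<close> leaves over.
  As \<open>T\<close> is disjoint from \<open>S\<close>, every vertex outside both gains a new
  in-neighbour; monotonicity of \<open>g\<close> bounds each round by
  \<open>g (card U)\<close>.\<close>

lemma ex_small_r_dominating_set:
  fixes g :: "nat \<Rightarrow> real"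
  assumes "finite U" "asym R" "indep_at_most R a U" "0 \<le> g 0" "mono g"
    and g: "\<And>m c. 0 < c \<Longrightarrow> c \<le> m \<Longrightarrow> m + a \<le> 2 * a * c \<Longrightarrow> 1 + g (m - c) \<le> g m"
  shows "\<exists>S\<subseteq>U. (\<forall>u\<in>U - S. r \<le> card {v\<in>S. (v, u) \<in> R}) \<and> real (card S) \<le> real r * g (card U)"
proof (induction r)
  case 0
  then show ?case by (intro exI[of _ "{}"]) simp
next
  case (Suc r)
  then obtain S where S: "S \<subseteq> U" "\<And>u. u \<in> U - S \<Longrightarrow> r \<le> card {v\<in>S. (v, u) \<in> R}"
    "real (card S) \<le> real r * g (card U)" by blast
  obtain T where T: "T \<subseteq> U - S" "\<And>u. u \<in> U - S - T \<Longrightarrow> \<exists>v\<in>T. (v, u) \<in> R"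
    "real (card T) \<le> g (card (U - S))"
    using ex_small_dominating_set[of "U - S" R a g] assms(1,2,4) g
      indep_at_most_subset[OF assms(3), of "U - S"] by blast
  have fin: "finite S" "finite T" using S(1) T(1) assms(1) by (auto intro: finite_subset)
  have "g (card (U - S)) \<le> g (card U)"
    using assms(1,5) by (intro monoD[of g] card_mono) auto
  moreover have "real (card (S \<union> T)) \<le> real (card S) + real (card T)"
    using card_Un_le[of S T] by linarith
  ultimately have "real (card (S \<union> T)) \<le> real (Suc r) * g (card U)"
    using S(3) T(3) by (simp add: algebra_simps)
  moreover have "Suc r \<le> card {v\<in>S \<union> T. (v, u) \<in> R}" if u: "u \<in> U - (S \<union> T)" for u
  proof -
    obtain w where w: "w \<in> T" "(w, u) \<in> R" using T(2)[of u] u by blast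
    then have "w \<notin> S" using T(1) by blast
    then have "Suc (card {v\<in>S. (v, u) \<in> R}) = card (insert w {v\<in>S. (v, u) \<in> R})"
      using fin by simp
    also have "\<dots> \<le> card {v\<in>S \<union> T. (v, u) \<in> R}"
      using fin w by (intro card_mono) auto
    finally show ?thesis using S(2)[of u] u by simp
  qed
  moreover have "S \<union> T \<subseteq> U" using S(1) T(1) by blast
  ultimately show ?case by blast
qed

section \<open>The two bounding functions\<close>

text \<open>The last assumption says that passing from \<open>m\<close> to \<open>m - c\<close> at
  least halves the quantity \<open>m + 1\<close>.\<close>

lemma log2_greedy_step:
  assumes "0 < c" "c \<le> m" "m + 1 \<le> 2 * c"
  shows "1 + log 2 (real (m - c) + 1) \<le> log 2 (real m + 1)"
proof -
  have "1 + log 2 (real (m - c) + 1) = log 2 (2 * (real (m - c) + 1))"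
    by (subst log_mult_pos) auto
  also have "\<dots> \<le> log 2 (real m + 1)"
    using assms by (subst log_le_cancel_iff) (auto simp: of_nat_diff)
  finally show ?thesis .
qed

text \<open>For \<open>0 < m < a\<close> the logarithmic expression lies below \<open>m\<close>, too
  small for \<open>m\<close> independent vertices; the trivial bound \<open>m\<close> replaces it.
  For \<open>a > 0\<close> both branches give \<open>a\<close> at \<open>m = a\<close>.\<close>

definition greedy_bound :: "nat \<Rightarrow> nat \<Rightarrow> real" where
  "greedy_bound a m = (if m \<le> a then real m else real a * (1 + 2 * ln (real m / real a)))"

lemma mono_greedy_bound: "0 < a \<Longrightarrow> mono (greedy_bound a)"
proof (rule monoI)
  fix x y :: nat assume a: "0 < a" and "x \<le> y"
  consider "y \<le> a" | "x \<le> a" "a < y" | "a < x" by linarith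
  then show "greedy_bound a x \<le> greedy_bound a y"
  proof cases
    case 2
    have "real a * 1 \<le> real a * (1 + 2 * ln (real y / real a))"
      using 2 a by (intro mult_left_mono) auto
    then show ?thesis using 2 by (simp add: greedy_bound_def)
  next
    case 3
    have "ln (real x / real a) \<le> ln (real y / real a)"
      using 3 a \<open>x \<le> y\<close> by (subst ln_le_cancel_iff) (auto simp: divide_right_mono)
    then show ?thesis using 3 \<open>x \<le> y\<close> by (simp add: greedy_bound_def mult_left_mono)
  qed (use \<open>x \<le> y\<close> in \<open>simp add: greedy_bound_def\<close>)
qed

lemma greedy_bound_step:
  assumes "0 < a" "0 < c" "c \<le> m" "m + a \<le> 2 * a * c"
  shows "1 + greedy_bound a (m - c) \<le> greedy_bound a m"
proof -
  consider "m \<le> a" | "a < m" "m - c < a" | "a \<le> m - c" "a < m" using assms by linarith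
  then show ?thesis
  proof cases
    case 1
    then show ?thesis using assms by (auto simp: greedy_bound_def of_nat_diff)
  next
    case 2
    \<comment> \<open>The step crosses the threshold: \<open>m - c < a\<close> are integers, so the
      added one still fits under \<open>a\<close>.\<close>
    have "1 + greedy_bound a (m - c) \<le> greedy_bound a a"
      using 2 by (simp add: greedy_bound_def)
    also have "\<dots> \<le> greedy_bound a m"
      using monoD[OF mono_greedy_bound[OF assms(1)], of a m] 2 by simp
    finally show ?thesis .
  next
    case 3
    define k where "k = real (m - c)"
    have k: "k = real m - real c" "real a \<le> k"
      using 3 assms by (auto simp: k_def of_nat_diff)
    have pos: "0 < real a" "0 < k" "0 < real m" using assms 3 k by auto
    have "real m \<le> 2 * real a * real c"
      using assms(4) by (metis add_leD1 of_nat_le_iff of_nat_mult of_nat_numeral)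
    then have "1 \<le> 2 * real a * (1 - k / real m)"
      using pos by (simp add: k field_simps)
    \<comment> \<open>This is \<open>ln x \<le> x - 1\<close> at \<open>x = k / m\<close>; the
      preceding line holds because \<open>1 - k / m = c / m\<close>.\<close>
    also have "\<dots> \<le> 2 * real a * (ln (real m) - ln k)"
      using ln_le_minus_one[of "k / real m"] pos by (intro mult_left_mono) (auto simp: ln_div)
    finally have "1 + real a * (1 + 2 * ln (k / real a)) \<le> greedy_bound a m"
      using pos 3 by (simp add: greedy_bound_def ln_div algebra_simps)
    \<comment> \<open>At \<open>m - c = a\<close> the linear branch applies, but
      \<open>ln 1 = 0\<close> makes the formulas agree.\<close>
    moreover have "greedy_bound a (m - c) = real a * (1 + 2 * ln (k / real a))"
    proof (cases "m - c = a")
      case True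
      then show ?thesis using pos by (simp add: greedy_bound_def k_def)
    next
      case False
      then show ?thesis using 3 by (simp add: greedy_bound_def k_def)
    qed
    ultimately show ?thesis by simp
  qed
qed

section \<open>Orientations and the extremal parameters\<close>

lemma orientation_asym: "orientation G D \<Longrightarrow> asym (parcs D)"
  unfolding orientation_def by (intro asymI) blast

text \<open>Direct every edge upwards along an injective numbering of the vertices. Existence makes
  the set under \<open>Max\<close> nonempty.\<close>

lemma ex_orientation:
  assumes "pair_graph G"
  shows "\<exists>D. orientation G D"
proof -
  interpret pair_graph G by fact
  obtain f :: "'a \<Rightarrow> nat" where f: "inj_on f (pverts G)"
    using finite_imp_inj_to_nat_seg[OF pair_finite_verts] by blast
  have "f u \<noteq> f v" if "(u, v) \<in> parcs G" for u v
    using f pair_no_loops[OF that] wellformed'[OF that] by (auto dest: inj_onD)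
  then have "orientation G \<lparr>pverts = pverts G, parcs = {(u, v) \<in> parcs G. f u < f v}\<rparr>"
    unfolding orientation_def using arcs_symmetric by force
  then show ?thesis by blast
qed

lemma directed_domination_number_le:
  assumes "finite (pverts D)" "directed_dominating_set r D S"
  shows "directed_domination_number r D \<le> card S"
proof -
  have "{card S | S. directed_dominating_set r D S} \<subseteq> card ` Pow (pverts D)"
    by (auto simp: directed_dominating_set_def)
  then have "finite {card S | S. directed_dominating_set r D S}"
    using assms(1) by (meson finite_Pow_iff finite_imageI finite_subset)
  then show ?thesis
    unfolding directed_domination_number_def using assms(2) by (intro Min_le) auto
qed

text \<open>The maximum is attained by some orientation, and any dominating set of that orientation
  bounds its minimum.\<close>

lemma upper_directed_domination_number_le:
  assumes "pair_graph G"
    and B: "\<And>D. orientation G D \<Longrightarrow> \<exists>S. directed_dominating_set r D S \<and> real (card S) \<le> B"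
  shows "real (upper_directed_domination_number r G) \<le> B"
proof -
  interpret pair_graph G by fact
  let ?X = "{directed_domination_number r D | D. orientation G D}"
  have fin: "finite (pverts D)" if "orientation G D" for D
    using that pair_finite_verts by (simp add: orientation_def)
  \<comment> \<open>Finiteness comes from bounding the values: the whole vertex set always
    dominates.\<close>
  have "?X \<subseteq> {..card (pverts G)}"
  proof clarsimp
    fix D assume D: "orientation G D"
    have "directed_dominating_set r D (pverts D)" by (simp add: directed_dominating_set_def)
    then show "directed_domination_number r D \<le> card (pverts G)"
      using directed_domination_number_le[OF fin[OF D]] D by (auto simp: orientation_def)
  qed
  then have "finite ?X" using finite_subset by blast
  moreover have "?X \<noteq> {}" using ex_orientation[OF assms(1)] by blast
  ultimately have "upper_directed_domination_number r G \<in> ?X"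
    unfolding upper_directed_domination_number_def by (rule Max_in)
  then obtain D where D: "orientation G D"
    "upper_directed_domination_number r G = directed_domination_number r D" by blast
  with B obtain S where "directed_dominating_set r D S" "real (card S) \<le> B" by blast
  then show ?thesis using directed_domination_number_le[OF fin[OF D(1)]] D(2) by fastforce
qed

text \<open>An orientation keeps an arc of every edge, so it has no independent sets beyond those of
  \<open>G\<close> and inherits the bound \<open>a\<close>.\<close>

lemma upper_directed_domination_number_le_greedy:
  fixes g :: "nat \<Rightarrow> real"
  assumes "pair_graph G" "indep_at_most (parcs G) a (pverts G)" "0 \<le> g 0" "mono g"
    and "\<And>m c. 0 < c \<Longrightarrow> c \<le> m \<Longrightarrow> m + a \<le> 2 * a * c \<Longrightarrow> 1 + g (m - c) \<le> g m"
  shows "real (upper_directed_domination_number r G) \<le> real r * g (card (pverts G))"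
proof (rule upper_directed_domination_number_le[OF assms(1)])
  interpret pair_graph G by fact
  fix D assume D: "orientation G D"
  have V: "pverts D = pverts G" using D by (simp add: orientation_def)
  have "I \<times> I \<inter> parcs G = {}" if "I \<times> I \<inter> parcs D = {}" for I
    using that D unfolding orientation_def by blast
  then have "indep_at_most (parcs D) a (pverts G)"
    unfolding indep_at_most_def by (intro allI impI indep_at_mostD[OF assms(2)])
  from ex_small_r_dominating_set[OF pair_finite_verts orientation_asym[OF D] this assms(3-5)]
  show "\<exists>S. directed_dominating_set r D S \<and> real (card S) \<le> real r * g (card (pverts G))"
    unfolding directed_dominating_set_def V by blast
qed

lemma card_le_independence_number:
  assumes "finite (pverts G)" "independent_set G I"
  shows "card I \<le> independence_number G"
proof -
  have "{card I | I. independent_set G I} \<subseteq> card ` Pow (pverts G)"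
    by (auto simp: independent_set_def)
  then have "finite {card I | I. independent_set G I}"
    using assms(1) by (meson finite_Pow_iff finite_imageI finite_subset)
  then show ?thesis unfolding independence_number_def using assms(2) by (intro Max_ge) auto
qed

lemma indep_at_most_independence_number:
  assumes "finite (pverts G)"
  shows "indep_at_most (parcs G) (independence_number G) (pverts G)"
  unfolding indep_at_most_def
  using card_le_independence_number[OF assms] by (auto simp: independent_set_def)

lemma independence_number_le_card:
  assumes "finite (pverts G)"
  shows "independence_number G \<le> card (pverts G)"
proof -
  have sub: "{card I | I. independent_set G I} \<subseteq> {..card (pverts G)}"
    using assms by (auto simp: independent_set_def intro: card_mono)
  moreover have "independent_set G {}" by (simp add: independent_set_def)
  ultimately have "independence_number G \<in> {card I | I. independent_set G I}"
    unfolding independence_number_def by (intro Max_in) (auto intro: finite_subset)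
  with sub show ?thesis by blast
qed

theorem theorem3p1:
  fixes r n \<alpha> :: nat
    and G :: "'a pair_pre_digraph"
    and K :: "'b pair_pre_digraph"
  assumes "r \<ge> 1"
    and "pair_graph G"
    and "card (pverts G) = n"
    and "independence_number G = \<alpha>"
  shows "(complete_digraph n (with_proj K) \<longrightarrow>
            real (upper_directed_domination_number r K) \<le> real r * log 2 (real n + 1)) \<and>
         real (upper_directed_domination_number r G)
           \<le> real r * real \<alpha> * (1 + 2 * ln (real n / real \<alpha>))"
proof (intro conjI impI)
  assume K: "complete_digraph n (with_proj K)"
  then have arcs: "parcs K = {(u, v). (u, v) \<in> pverts K \<times> pverts K \<and> u \<noteq> v}"
    and n: "card (pverts K) = n" and fin: "finite (pverts K)"
    by (simp_all add: complete_digraph_pair_def)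
  have "card I \<le> 1" if "I \<subseteq> pverts K" "I \<times> I \<inter> parcs K = {}" for I
    using that finite_subset[OF that(1) fin] card_le_Suc0_iff_eq[of I] by (auto simp: arcs)
  then have "indep_at_most (parcs K) 1 (pverts K)" by (simp add: indep_at_most_def)
  moreover have "mono (\<lambda>m. log 2 (real m + 1))" by (intro monoI) simp
  ultimately have "real (upper_directed_domination_number r K)
      \<le> real r * (\<lambda>m. log 2 (real m + 1)) (card (pverts K))"
    using log2_greedy_step
    by (intro upper_directed_domination_number_le_greedy[OF pair_graphI_complete[OF K], of 1]) auto
  then show "real (upper_directed_domination_number r K) \<le> real r * log 2 (real n + 1)"
    by (simp add: n)
next
  interpret pair_graph G by fact
  have indep: "indep_at_most (parcs G) \<alpha> (pverts G)"
    using indep_at_most_independence_number[OF pair_finite_verts] assms(4) by simp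
  have "\<alpha> \<le> n" using independence_number_le_card[OF pair_finite_verts] assms(3,4) by simp
  show "real (upper_directed_domination_number r G)
      \<le> real r * real \<alpha> * (1 + 2 * ln (real n / real \<alpha>))"
  proof (cases "\<alpha> = 0")
    case True
    \<comment> \<open>The right-hand side is now zero. For \<open>a = 0\<close> the recursive
      inequality holds vacuously, so the identity serves as \<open>g\<close>; Turan's bound then
      shows that there are no vertices.\<close>
    have "real (upper_directed_domination_number r G) \<le> real r * (\<lambda>m. real m) (card (pverts G))"
      by (rule upper_directed_domination_number_le_greedy[OF assms(2) indep])
        (auto simp: True intro: monoI)
    moreover have "(card (pverts G))\<^sup>2 \<le> 0"
      using turan_closed_degrees[OF pair_finite_verts, of "parcs G" \<alpha>] indep True
        pair_no_loops pair_sym_arcs by (force simp: irrefl_def symmetric_def)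
    ultimately show ?thesis by (simp add: True)
  next
    case False
    have "real (upper_directed_domination_number r G) \<le> real r * greedy_bound \<alpha> (card (pverts G))"
      using False
      by (intro upper_directed_domination_number_le_greedy[OF assms(2) indep])
        (auto simp: greedy_bound_def[of _ 0] mono_greedy_bound greedy_bound_step)
    \<comment> \<open>If \<open>n = \<alpha>\<close>, the linear branch gives
      \<open>\<alpha>\<close> and the logarithm vanishes; otherwise \<open>n > \<alpha>\<close>
      selects the logarithmic branch.\<close>
    also have "\<dots> = real r * real \<alpha> * (1 + 2 * ln (real n / real \<alpha>))"
      using False \<open>\<alpha> \<le> n\<close> by (auto simp: greedy_bound_def assms(3))
    finally show ?thesis .
  qed
qed

end
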